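(* Let $\mathsf{Circ}_{\mathsf{CP}}(\mathcal{T},\mathcal{A})$ be a concept-circumscribed knowledge base in $\mathcal{ALC}$ with $\mathcal{A}=\emptyset$ and $\mathsf{CP}=(M,F,V)$, where $F=\emptyset$ and $M=\{M_1,\dots,M_q\}$ is a set of concept names, and let $C_0$ be an $\mathcal{ALC}$ concept. Let $\mathcal{K}'=(\mathcal{T}',\mathcal{A}')$ and $C_0'$ be the $\mathcal{ALC}+\mathbf{T}^+$ knowledge base with two typicality operators $\mathbf{T}_1,\mathbf{T}_2$ and the concept defined as follows. Let $D$ and $A$ be fresh concept names and let $c,c_{m_1},\dots,c_{m_q}$ be distinct individual names. $\mathcal{T}'$ consists of - $D\sqcap C_1^*\sqsubseteq C_2^*$ for every $C_1\sqsubseteq C_2\in\mathcal{T}$, - $D\sqcap M_i\sqsubseteq\neg\mathbf{T}_1(M_i)$ for all $M_i\in M$, - $\top\sqsubseteq A$, - $\neg D\sqsubseteq\neg\mathbf{T}_2(A)$; $\mathcal{A}'$ consists of $D(c)$ and, for each $M_i\in M$, the assertions $(\neg D)(c_{m_i})$, $(\mathbf{T}_1(M_i))(c_{m_i})$, and $(\neg M_j)(c_{m_i})$ for all $j\ne i$; and $C_0'=D\sqcap C_0^*$. Then $C_0$ is satisfiable in $\mathsf{Circ}_{\mathsf{CP}}(\mathcal{T},\mathcal{A})$ if and only if $C_0'$ is satisfiable with respect to $\mathcal{K}'$ in $\mathcal{ALC}+\mathbf{T}^+_{\mathsf{min}}$ with $\mathcal{L}_{\mathbf{T}_1}=M$ and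 $\mathcal{L}_{\mathbf{T}_2}=\{A\}$.
   Context: Transformation $C\mapsto C^*$ of $\mathcal{ALC}$ concepts: $B^*=B$ for concept names $B$, $(\neg C)^*=\neg C^*$, $(C_1\sqcap C_2)^*=C_1^*\sqcap C_2^*$, $(\exists r.C_1)^*=\exists r.(D\sqcap C_1^* )$. Circumscription. In $\mathsf{Circ}_{\mathsf{CP}}(\mathcal{T},\mathcal{A})$ with $\mathsf{CP}=(M,F,V)$, the sets $M,F,V$ partition the concept and role names used in $(\mathcal{T},\mathcal{A})$ ($M$ minimized, $F$ fixed, $V$ varying); it is concept-circumscribed if $M\cup F$ contains only concept names. $\mathcal{I}<_{\mathsf{CP}}\mathcal{J}$ iff $\Delta^{\mathcal{I}}=\Delta^{\mathcal{J}}$, $a^{\mathcal{I}}=a^{\mathcal{J}}$ for all individual names $a$, $B^{\mathcal{I}}=B^{\mathcal{J}}$ for $B\in F$, $B^{\mathcal{I}}\subseteq B^{\mathcal{J}}$ for all $B\in M$, with strict inclusion for some $B\in M$. A model of $\mathsf{Circ}_{\mathsf{CP}}(\mathcal{T},\mathcal{A})$ is a model $\mathcal{I}$ of $(\mathcal{T},\mathcal{A})$ such that no model $\mathcal{I}'$ of $(\mathcal{T},\mathcal{A})$ has $\mathcal{I}'<_{\mathsf{CP}}\mathcal{I}$. $C_0$ is satisfiable in $\mathsf{Circ}_{\mathsf{CP}}(\mathcal{T},\mathcal{A})$ iff some model $\mathcal{I}$ of it has $C_0^{\mathcal{I}}\ne\emptyset$. $\mathcal{ALC}+\mathbf{T}^+$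 (here with two operators). Interpretations are $\mathcal{I}=(\Delta^{\mathcal{I}},\cdot^{\mathcal{I}},<_1,<_2)$: an $\mathcal{ALC}$ interpretation with irreflexive transitive relations $<_i$ on $\Delta^{\mathcal{I}}$ satisfying the Smoothness Condition: for all $S\subseteq\Delta^{\mathcal{I}}$, $x\in S$, either $x\in\mathsf{Min}_{<_i}(S)$ or some $y\in\mathsf{Min}_{<_i}(S)$ has $y<_i x$, where $\mathsf{Min}_{<_i}(S)=\{x\in S\mid\nexists y\in S: y<_i x\}$. $[\mathbf{T}_i(B)]^{\mathcal{I}}=\mathsf{Min}_{<_i}(B^{\mathcal{I}})$ for concept names $B$; other constructors as in $\mathcal{ALC}$. (A statement $C\sqsubseteq\neg\mathbf{T}_i(B)$ is read as the inclusion $C^{\mathcal{I}}\subseteq\Delta^{\mathcal{I}}\setminus[\mathbf{T}_i(B)]^{\mathcal{I}}$, equivalently as $\mathbf{T}_i(B)\sqsubseteq\neg C$.) Put $(\neg\Box_i\neg B)^{\mathcal{I}}=\{x\mid\exists y<_i x,\ y\in B^{\mathcal{I}}\}$ and $\mathcal{I}^{\Box^-}_i=\{(x,\neg\Box_i\neg B)\mid x\in(\neg\Box_i\neg B)^{\mathcal{I}},\ B\in\mathcal{L}_{\mathbf{T}_i}\}$. $\mathcal{I}$ is preferred to $\mathcal{J}$ iff they have the same domain and interpretation of individual names, $\mathcal{I}^{\Box^-}_i\subseteq\mathcal{J}^{\Box^-}_i$ for $i=1,2$, with strict inclusion for some $i$. A minimal model of $\mathcal{K}'$ is a model of $\mathcal{K}'$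 to which no model of $\mathcal{K}'$ is preferred. $C_0'$ is satisfiable w.r.t. $\mathcal{K}'$ in $\mathcal{ALC}+\mathbf{T}^+_{\mathsf{min}}$ iff some minimal model $\mathcal{I}$ of $\mathcal{K}'$ has $C_0'^{\mathcal{I}}\neq\emptyset$. "Fresh" means not occurring in $\mathcal{T}$, $M$ or $C_0$. *)

theory Defs
  imports Main
begin

section \<open>Concepts and knowledge bases\<close>

text \<open>
  Concepts are built over an arbitrary type of atoms: \<open>ALC\<close> concepts have concept names as atoms,
  \<open>ALC + T\<close> concepts additionally have the atoms \<open>T\<^sub>i(B)\<close>.  The constructors \<open>\<bottom>\<close>, \<open>\<squnion>\<close> and \<open>\<forall>r.C\<close> are
  the usual abbreviations.
\<close>

datatype (cnames: 'a, rnames: 'r) concept =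
    Top
  | Atom 'a
  | Neg "('a, 'r) concept"
  | Conj "('a, 'r) concept" "('a, 'r) concept"
  | Ex 'r "('a, 'r) concept"

text \<open>A pair \<open>(C\<^sub>1, C\<^sub>2)\<close> in a TBox stands for the inclusion of \<open>C\<^sub>1\<close> in \<open>C\<^sub>2\<close>.\<close>

type_synonym ('a, 'r) tbox = "(('a, 'r) concept \<times> ('a, 'r) concept) set"

datatype (acnames: 'a, arnames: 'r, 'i) assertion =
    CAssert "('a, 'r) concept" 'i
  | RAssert 'r 'i 'i

type_synonym ('a, 'r, 'i) abox = "('a, 'r, 'i) assertion set"

definition kb_cnames :: "('a, 'r) tbox \<Rightarrow> ('a, 'r, 'i) abox \<Rightarrow> 'a set" where
  "kb_cnames \<T> \<A> = (\<Union>(C1, C2)\<in>\<T>. cnames C1 \<union> cnames C2) \<union> (\<Union>\<alpha>\<in>\<A>. acnames \<alpha>)"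

definition kb_rnames :: "('a, 'r) tbox \<Rightarrow> ('a, 'r, 'i) abox \<Rightarrow> 'r set" where
  "kb_rnames \<T> \<A> = (\<Union>(C1, C2)\<in>\<T>. rnames C1 \<union> rnames C2) \<union> (\<Union>\<alpha>\<in>\<A>. arnames \<alpha>)"


section \<open>Semantics of \<open>ALC\<close>\<close>

record ('c, 'r, 'i, 'd) interp =
  universe :: "'d set"
  cext :: "'c \<Rightarrow> 'd set"
  rext :: "'r \<Rightarrow> ('d \<times> 'd) set"
  ind :: "'i \<Rightarrow> 'd"

definition is_interp :: "('c, 'r, 'i, 'd, 'z) interp_scheme \<Rightarrow> bool" where
  "is_interp I \<longleftrightarrow>
     universe I \<noteq> {} \<and>
     (\<forall>B. cext I B \<subseteq> universe I) \<and>
     (\<forall>r. rext I r \<subseteq> universe I \<times> universe I) \<and>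
     (\<forall>a. ind I a \<in> universe I)"

text \<open>The extension of the atoms is a parameter \<open>at\<close>, so that the semantics is shared by both logics.\<close>

primrec ext_with ::
  "('a \<Rightarrow> 'd set) \<Rightarrow> ('c, 'r, 'i, 'd, 'z) interp_scheme \<Rightarrow> ('a, 'r) concept \<Rightarrow> 'd set" where
  "ext_with at I Top = universe I"
| "ext_with at I (Atom B) = at B"
| "ext_with at I (Neg C) = universe I - ext_with at I C"
| "ext_with at I (Conj C1 C2) = ext_with at I C1 \<inter> ext_with at I C2"
| "ext_with at I (Ex r C) = {x \<in> universe I. \<exists>y. (x, y) \<in> rext I r \<and> y \<in> ext_with at I C}"

primrec sat_assertion ::
  "('a \<Rightarrow> 'd set) \<Rightarrow> ('c, 'r, 'i, 'd, 'z) interp_scheme \<Rightarrow> ('a, 'r, 'i) assertion \<Rightarrow> bool" where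
  "sat_assertion at I (CAssert C a) \<longleftrightarrow> ind I a \<in> ext_with at I C"
| "sat_assertion at I (RAssert r a b) \<longleftrightarrow> (ind I a, ind I b) \<in> rext I r"

definition sat_kb ::
  "('a \<Rightarrow> 'd set) \<Rightarrow> ('c, 'r, 'i, 'd, 'z) interp_scheme \<Rightarrow>
   ('a, 'r) tbox \<Rightarrow> ('a, 'r, 'i) abox \<Rightarrow> bool" where
  "sat_kb at I \<T> \<A> \<longleftrightarrow>
     (\<forall>(C1, C2)\<in>\<T>. ext_with at I C1 \<subseteq> ext_with at I C2) \<and>
     (\<forall>\<alpha>\<in>\<A>. sat_assertion at I \<alpha>)"

abbreviation alc_ext :: "('c, 'r, 'i, 'd) interp \<Rightarrow> ('c, 'r) concept \<Rightarrow> 'd set" where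
  "alc_ext I \<equiv> ext_with (cext I) I"

definition alc_model ::
  "('c, 'r) tbox \<Rightarrow> ('c, 'r, 'i) abox \<Rightarrow> ('c, 'r, 'i, 'd) interp \<Rightarrow> bool" where
  "alc_model \<T> \<A> I \<longleftrightarrow> is_interp I \<and> sat_kb (cext I) I \<T> \<A>"


section \<open>Circumscription\<close>

text \<open>
  Only concept names can be minimized or fixed here: the types enforce that knowledge bases are
  concept-circumscribed.
\<close>

record ('c, 'r) circ_pattern =
  minimized :: "'c set"
  fixed :: "'c set"
  varying :: "('c + 'r) set"

definition circ_pattern_for ::
  "('c, 'r) tbox \<Rightarrow> ('c, 'r, 'i) abox \<Rightarrow> ('c, 'r) circ_pattern \<Rightarrow> bool" where
  "circ_pattern_for \<T> \<A> CP \<longleftrightarrow>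
     Inl ` minimized CP \<union> Inl ` fixed CP \<union> varying CP
       = Inl ` kb_cnames \<T> \<A> \<union> Inr ` kb_rnames \<T> \<A> \<and>
     minimized CP \<inter> fixed CP = {} \<and>
     Inl ` minimized CP \<inter> varying CP = {} \<and>
     Inl ` fixed CP \<inter> varying CP = {}"

definition circ_less ::
  "('c, 'r) circ_pattern \<Rightarrow> ('c, 'r, 'i, 'd) interp \<Rightarrow> ('c, 'r, 'i, 'd) interp \<Rightarrow> bool" where
  "circ_less CP I J \<longleftrightarrow>
     universe I = universe J \<and>
     (\<forall>a. ind I a = ind J a) \<and>
     (\<forall>B\<in>fixed CP. cext I B = cext J B) \<and>
     (\<forall>B\<in>minimized CP. cext I B \<subseteq> cext J B) \<and>
     (\<exists>B\<in>minimized CP. cext I B \<subset> cext J B)"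

definition circ_model ::
  "('c, 'r) circ_pattern \<Rightarrow> ('c, 'r) tbox \<Rightarrow> ('c, 'r, 'i) abox \<Rightarrow>
   ('c, 'r, 'i, 'd) interp \<Rightarrow> bool" where
  "circ_model CP \<T> \<A> I \<longleftrightarrow>
     alc_model \<T> \<A> I \<and> \<not> (\<exists>I'. alc_model \<T> \<A> I' \<and> circ_less CP I' I)"

text \<open>
  Satisfiability is relative to a type \<open>'d\<close> whose subsets serve as domains, since one cannot quantify
  over types inside a formula.  Models are only compared when they have the same domain, so minimality
  does not depend on the choice of \<open>'d\<close>; only the sizes of the available domains do.
\<close>

definition circ_satisfiable ::
  "'d itself \<Rightarrow> ('c, 'r) circ_pattern \<Rightarrow> ('c, 'r) tbox \<Rightarrow> ('c, 'r, 'i) abox \<Rightarrow>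
   ('c, 'r) concept \<Rightarrow> bool" where
  "circ_satisfiable _ CP \<T> \<A> C \<longleftrightarrow>
     (\<exists>I :: ('c, 'r, 'i, 'd) interp. circ_model CP \<T> \<A> I \<and> alc_ext I C \<noteq> {})"


section \<open>The logic with two typicality operators\<close>

datatype typ_op = Op1 | Op2

datatype 'c tatom = Nm 'c | Typ typ_op 'c

type_synonym ('c, 'r) tconcept = "('c tatom, 'r) concept"
type_synonym ('c, 'r) ttbox = "('c tatom, 'r) tbox"
type_synonym ('c, 'r, 'i) tabox = "('c tatom, 'r, 'i) abox"

text \<open>\<open>(y, x) \<in> prec I i\<close> means \<open>y <\<^sub>i x\<close>.\<close>

record ('c, 'r, 'i, 'd) tinterp = "('c, 'r, 'i, 'd) interp" +
  prec :: "typ_op \<Rightarrow> ('d \<times> 'd) set"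

definition Min_elems :: "('d \<times> 'd) set \<Rightarrow> 'd set \<Rightarrow> 'd set" where
  "Min_elems R S = {x \<in> S. \<not> (\<exists>y\<in>S. (y, x) \<in> R)}"

definition is_tinterp :: "('c, 'r, 'i, 'd) tinterp \<Rightarrow> bool" where
  "is_tinterp I \<longleftrightarrow>
     is_interp I \<and>
     (\<forall>i. prec I i \<subseteq> universe I \<times> universe I \<and> irrefl (prec I i) \<and> trans (prec I i) \<and>
        (\<forall>S\<subseteq>universe I. \<forall>x\<in>S.
           x \<in> Min_elems (prec I i) S \<or> (\<exists>y\<in>Min_elems (prec I i) S. (y, x) \<in> prec I i)))"

primrec tatom_ext :: "('c, 'r, 'i, 'd) tinterp \<Rightarrow> 'c tatom \<Rightarrow> 'd set" where
  "tatom_ext I (Nm B) = cext I B"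
| "tatom_ext I (Typ i B) = Min_elems (prec I i) (cext I B)"

abbreviation t_ext :: "('c, 'r, 'i, 'd) tinterp \<Rightarrow> ('c, 'r) tconcept \<Rightarrow> 'd set" where
  "t_ext I \<equiv> ext_with (tatom_ext I) I"

definition t_model ::
  "('c, 'r) ttbox \<Rightarrow> ('c, 'r, 'i) tabox \<Rightarrow> ('c, 'r, 'i, 'd) tinterp \<Rightarrow> bool" where
  "t_model \<T> \<A> I \<longleftrightarrow> is_tinterp I \<and> sat_kb (tatom_ext I) I \<T> \<A>"

definition neg_box_neg :: "('c, 'r, 'i, 'd) tinterp \<Rightarrow> typ_op \<Rightarrow> 'c \<Rightarrow> 'd set" where
  "neg_box_neg I i B = {x \<in> universe I. \<exists>y. (y, x) \<in> prec I i \<and> y \<in> cext I B}"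

text \<open>The pair \<open>(x, \<not>\<box>\<^sub>i\<not>B)\<close> is represented by \<open>(x, B)\<close>; the family \<open>L\<close> gives the sets \<open>L\<^sub>T\<^sub>i\<close>.\<close>

definition box_minus ::
  "(typ_op \<Rightarrow> 'c set) \<Rightarrow> ('c, 'r, 'i, 'd) tinterp \<Rightarrow> typ_op \<Rightarrow> ('d \<times> 'c) set" where
  "box_minus L I i = {(x, B). x \<in> neg_box_neg I i B \<and> B \<in> L i}"

definition preferred ::
  "(typ_op \<Rightarrow> 'c set) \<Rightarrow> ('c, 'r, 'i, 'd) tinterp \<Rightarrow> ('c, 'r, 'i, 'd) tinterp \<Rightarrow> bool" where
  "preferred L I J \<longleftrightarrow>
     universe I = universe J \<and>
     (\<forall>a. ind I a = ind J a) \<and>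
     (\<forall>i. box_minus L I i \<subseteq> box_minus L J i) \<and>
     (\<exists>i. box_minus L I i \<subset> box_minus L J i)"

definition t_min_model ::
  "(typ_op \<Rightarrow> 'c set) \<Rightarrow> ('c, 'r) ttbox \<Rightarrow> ('c, 'r, 'i) tabox \<Rightarrow>
   ('c, 'r, 'i, 'd) tinterp \<Rightarrow> bool" where
  "t_min_model L \<T> \<A> I \<longleftrightarrow>
     t_model \<T> \<A> I \<and> \<not> (\<exists>I'. t_model \<T> \<A> I' \<and> preferred L I' I)"

definition t_min_satisfiable ::
  "'d itself \<Rightarrow> (typ_op \<Rightarrow> 'c set) \<Rightarrow> ('c, 'r) ttbox \<Rightarrow> ('c, 'r, 'i) tabox \<Rightarrow>
   ('c, 'r) tconcept \<Rightarrow> bool" where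
  "t_min_satisfiable _ L \<T> \<A> C \<longleftrightarrow>
     (\<exists>I :: ('c, 'r, 'i, 'd) tinterp. t_min_model L \<T> \<A> I \<and> t_ext I C \<noteq> {})"


section \<open>The translation\<close>

text \<open>The clause for \<open>Top\<close> agrees, up to equivalence, with reading \<open>\<top>\<close> as \<open>\<not>(B \<sqinter> \<not>B)\<close>.\<close>

primrec star :: "'c \<Rightarrow> ('c, 'r) concept \<Rightarrow> ('c, 'r) concept" where
  "star D Top = Top"
| "star D (Atom B) = Atom B"
| "star D (Neg C) = Neg (star D C)"
| "star D (Conj C1 C2) = Conj (star D C1) (star D C2)"
| "star D (Ex r C) = Ex r (Conj (Atom D) (star D C))"

abbreviation emb :: "('c, 'r) concept \<Rightarrow> ('c, 'r) tconcept" where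
  "emb \<equiv> map_concept Nm id"

abbreviation Name :: "'c \<Rightarrow> ('c, 'r) tconcept" where
  "Name B \<equiv> Atom (Nm B)"

abbreviation Typical :: "typ_op \<Rightarrow> 'c \<Rightarrow> ('c, 'r) tconcept" where
  "Typical i B \<equiv> Atom (Typ i B)"

definition trans_tbox :: "'c \<Rightarrow> 'c \<Rightarrow> 'c set \<Rightarrow> ('c, 'r) tbox \<Rightarrow> ('c, 'r) ttbox" where
  "trans_tbox D A M \<T> =
     {(Conj (Name D) (emb (star D C1)), emb (star D C2)) | C1 C2. (C1, C2) \<in> \<T>} \<union>
     {(Conj (Name D) (Name B), Neg (Typical Op1 B)) | B. B \<in> M} \<union>
     {(Top, Name A)} \<union>
     {(Neg (Name D), Neg (Typical Op2 A))}"

text \<open>\<open>cm B\<close> is the individual name attached to the minimized concept name \<open>B\<close>.\<close>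

definition trans_abox :: "'c \<Rightarrow> 'c set \<Rightarrow> 'i \<Rightarrow> ('c \<Rightarrow> 'i) \<Rightarrow> ('c, 'r, 'i) tabox" where
  "trans_abox D M c cm =
     {CAssert (Name D) c} \<union>
     {CAssert (Neg (Name D)) (cm B) | B. B \<in> M} \<union>
     {CAssert (Typical Op1 B) (cm B) | B. B \<in> M} \<union>
     {CAssert (Neg (Name B')) (cm B) | B B'. B \<in> M \<and> B' \<in> M \<and> B' \<noteq> B}"

definition trans_concept :: "'c \<Rightarrow> ('c, 'r) concept \<Rightarrow> ('c, 'r) tconcept" where
  "trans_concept D C = Conj (Name D) (emb (star D C))"

definition trans_L :: "'c \<Rightarrow> 'c set \<Rightarrow> typ_op \<Rightarrow> 'c set" where
  "trans_L A M i = (case i of Op1 \<Rightarrow> M | Op2 \<Rightarrow> {A})"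

end

theory Submission
  imports Defs
begin

text \<open>
  Inside \<open>D\<close> a minimized name \<open>B\<close> has no typical instance, so every instance of \<open>B\<close> in \<open>D\<close> has a
  smaller element (for the first order) in \<open>B\<close>.  Conversely, if the element \<open>e B\<close> denoted by
  \<open>cm B\<close> is put below exactly the instances of \<open>B\<close> in \<open>D\<close>, nothing else is forced: the pairs \<open>(x, B)\<close>
  to be minimized for \<open>T\<^sub>1\<close> then coincide with the extensions of the minimized names within \<open>D\<close>.
  The operator \<open>T\<^sub>2\<close> makes every element outside \<open>D\<close> contribute a pair, which prevents \<open>D\<close> from
  shrinking in a preferred model.  Hence restricting a model to \<open>D\<close> and adjoining the elements
  \<open>e B\<close> carry the two preference relations into each other.  If the domain of an \<open>ALC\<close> model leaves
  no room for these elements, the model is first transported along an injection that misses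
  finitely many points.
\<close>

section \<open>Relativization to \<open>D\<close>\<close>

lemma ext_with_subset_universe:
  assumes "\<And>B. at B \<subseteq> universe I"
  shows "ext_with at I C \<subseteq> universe I"
  using assms by (induction C) auto

text \<open>Only traces on \<open>universe I\<close> are compared, so negation may be taken in the
  larger universe. In an existential restriction the guard \<open>D\<close> inserted by
  \<open>star\<close> keeps the witness inside \<open>universe I\<close>. Agreement is asked only
  for names in \<open>C\<close>, which leaves \<open>J\<close> free on the fresh names.\<close>

lemma alc_ext_eq_t_ext_emb_star:
  fixes I :: "('c, 'r, 'i, 'd) interp" and J :: "('c, 'r, 'j, 'd) tinterp"
  assumes I: "is_interp I"
    and D: "cext J D = universe I" "universe I \<subseteq> universe J"
    and cext: "\<And>B. B \<in> cnames C \<Longrightarrow> cext I B = cext J B \<inter> universe I"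
    and rext: "\<And>r. rext I r = rext J r \<inter> universe I \<times> universe I"
  shows "alc_ext I C = t_ext J (emb (star D C)) \<inter> universe I"
  using cext
proof (induction C)
  case (Ex r C)
  have "alc_ext I C \<subseteq> universe I"
    using I by (intro ext_with_subset_universe) (auto simp: is_interp_def)
  with Ex D rext[of r] show ?case by auto
qed (use D in auto)

section \<open>Semantic content of the translated axioms and assertions\<close>

lemma sat_kb_trans_tboxD:
  assumes "sat_kb at I (trans_tbox D A M \<T>) \<A>"
  shows "(C1, C2) \<in> \<T> \<Longrightarrow>
      ext_with at I (emb (star D C1)) \<inter> at (Nm D) \<subseteq> ext_with at I (emb (star D C2))"
    and "B \<in> M \<Longrightarrow> at (Nm D) \<inter> at (Nm B) \<inter> at (Typ Op1 B) = {}"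
    and "universe I \<subseteq> at (Nm A)"
    and "universe I \<inter> at (Typ Op2 A) \<subseteq> at (Nm D)"
proof -
  have *: "ext_with at I C \<subseteq> ext_with at I C'" if "(C, C') \<in> trans_tbox D A M \<T>" for C C'
    using assms that by (auto simp: sat_kb_def)
  show "ext_with at I (emb (star D C1)) \<inter> at (Nm D) \<subseteq> ext_with at I (emb (star D C2))"
    if "(C1, C2) \<in> \<T>"
  proof -
    have "(Conj (Name D) (emb (star D C1)), emb (star D C2)) \<in> trans_tbox D A M \<T>"
      using that by (auto simp: trans_tbox_def)
    from *[OF this] show ?thesis by (simp add: Int_commute)
  qed
  show "at (Nm D) \<inter> at (Nm B) \<inter> at (Typ Op1 B) = {}" if "B \<in> M"
    using that *[of "Conj (Name D) (Name B)" "Neg (Typical Op1 B)"] by (auto simp: trans_tbox_def)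
  show "universe I \<subseteq> at (Nm A)"
    using *[of Top "Name A"] by (simp add: trans_tbox_def)
  show "universe I \<inter> at (Typ Op2 A) \<subseteq> at (Nm D)"
    using *[of "Neg (Name D)" "Neg (Typical Op2 A)"] by (auto simp: trans_tbox_def)
qed

lemma sat_kb_trans_aboxD:
  assumes "sat_kb at I \<T> (trans_abox D M c cm)"
  shows "ind I c \<in> at (Nm D)"
    and "B \<in> M \<Longrightarrow> ind I (cm B) \<in> universe I - at (Nm D)"
    and "B \<in> M \<Longrightarrow> ind I (cm B) \<in> at (Typ Op1 B)"
    and "B \<in> M \<Longrightarrow> B' \<in> M \<Longrightarrow> B' \<noteq> B \<Longrightarrow> ind I (cm B) \<notin> at (Nm B')"
proof -
  have *: "sat_assertion at I \<alpha>" if "\<alpha> \<in> trans_abox D M c cm" for \<alpha>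
    using assms that by (simp add: sat_kb_def)
  show "ind I c \<in> at (Nm D)"
    using *[of "CAssert (Name D) c"] by (simp add: trans_abox_def)
  show "ind I (cm B) \<in> universe I - at (Nm D)" if "B \<in> M"
    using that *[of "CAssert (Neg (Name D)) (cm B)"] by (auto simp: trans_abox_def)
  show "ind I (cm B) \<in> at (Typ Op1 B)" if "B \<in> M"
    using that *[of "CAssert (Typical Op1 B) (cm B)"] by (auto simp: trans_abox_def)
  show "ind I (cm B) \<notin> at (Nm B')" if "B \<in> M" "B' \<in> M" "B' \<noteq> B"
    using that *[of "CAssert (Neg (Name B')) (cm B)"] by (auto simp: trans_abox_def)
qed

text \<open>The individuals are supplied separately as \<open>nd\<close>: in a model of the
  translated knowledge base, \<open>ind J\<close> leaves \<open>D\<close> at each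
  \<open>cm B\<close> with \<open>B\<close> in \<open>M\<close>.\<close>

definition restrict_interp ::
  "'c \<Rightarrow> ('i \<Rightarrow> 'd) \<Rightarrow> ('c, 'r, 'i, 'd) tinterp \<Rightarrow> ('c, 'r, 'i, 'd) interp" where
  "restrict_interp D nd J =
     \<lparr>universe = cext J D, cext = \<lambda>B. cext J B \<inter> cext J D,
      rext = \<lambda>r. rext J r \<inter> cext J D \<times> cext J D, ind = nd\<rparr>"

lemma restrict_interp_simps [simp]:
  "universe (restrict_interp D nd J) = cext J D"
  "cext (restrict_interp D nd J) B = cext J B \<inter> cext J D"
  "rext (restrict_interp D nd J) r = rext J r \<inter> cext J D \<times> cext J D"
  "ind (restrict_interp D nd J) = nd"
  by (simp_all add: restrict_interp_def)

lemma is_interp_restrict_interp: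
  assumes "\<And>a. nd a \<in> cext J D"
  shows "is_interp (restrict_interp D nd J)"
  using assms by (auto simp: is_interp_def)

lemma alc_ext_restrict_interp:
  assumes "is_tinterp J" and "\<And>a. nd a \<in> cext J D"
  shows "alc_ext (restrict_interp D nd J) C = t_ext J (emb (star D C)) \<inter> cext J D"
proof -
  have "cext J D \<subseteq> universe J"
    using assms(1) by (simp add: is_tinterp_def is_interp_def)
  moreover have "is_interp (restrict_interp D nd J)"
    using assms(2) by (rule is_interp_restrict_interp)
  ultimately show ?thesis
    using alc_ext_eq_t_ext_emb_star[where I = "restrict_interp D nd J" and J = J] by simp
qed

text \<open>Every translated inclusion is guarded by \<open>D\<close> and so survives the
  restriction; the empty ABox puts no demand on \<open>nd\<close>.\<close>

lemma alc_model_restrict_interp: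
  assumes "t_model (trans_tbox D A M \<T>) \<A> J" and "\<And>a. nd a \<in> cext J D"
  shows "alc_model \<T> {} (restrict_interp D nd J)"
proof -
  have "is_tinterp J" and sat: "sat_kb (tatom_ext J) J (trans_tbox D A M \<T>) \<A>"
    using assms(1) by (auto simp: t_model_def)
  then show ?thesis
    using sat_kb_trans_tboxD(1)[OF sat]
    by (auto simp: alc_model_def sat_kb_def is_interp_restrict_interp alc_ext_restrict_interp
        assms(2))
qed

lemma trans_L_simps [simp]: "trans_L A M Op1 = M" "trans_L A M Op2 = {A}"
  by (simp_all add: trans_L_def)

text \<open>An instance of \<open>B\<close> in \<open>D\<close> is not minimal in \<open>B\<close>,
  so another instance of \<open>B\<close> lies below it.\<close>

lemma box_minus_Op1_if_in_D:
  assumes "t_model (trans_tbox D A M \<T>) \<A> J" and "B \<in> M" and "x \<in> cext J B" and "x \<in> cext J D"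
  shows "(x, B) \<in> box_minus (trans_L A M) J Op1"
proof -
  have "sat_kb (tatom_ext J) J (trans_tbox D A M \<T>) \<A>" and "x \<in> universe J"
    using assms by (auto simp: t_model_def is_tinterp_def is_interp_def)
  with sat_kb_trans_tboxD(2)[of "tatom_ext J" J D A M \<T> \<A> B] assms show ?thesis
    by (auto simp: box_minus_def neg_box_neg_def Min_elems_def)
qed

text \<open>\<open>A\<close> is the whole universe and has no minimal elements outside
  \<open>D\<close>, so something lies below \<open>x\<close>.\<close>

lemma box_minus_Op2_if_not_in_D:
  assumes "t_model (trans_tbox D A M \<T>) \<A> J" and "x \<in> universe J" and "x \<notin> cext J D"
  shows "(x, A) \<in> box_minus (trans_L A M) J Op2"
proof -
  have "sat_kb (tatom_ext J) J (trans_tbox D A M \<T>) \<A>"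
    using assms by (simp add: t_model_def)
  from sat_kb_trans_tboxD(3,4)[OF this] assms have "x \<in> cext J A - Min_elems (prec J Op2) (cext J A)"
    by auto
  with assms(2) show ?thesis
    by (auto simp: box_minus_def neg_box_neg_def Min_elems_def)
qed


section \<open>Adjoining typical elements\<close>

definition extend_interp ::
  "'c \<Rightarrow> 'c \<Rightarrow> 'c set \<Rightarrow> ('c \<Rightarrow> 'd) \<Rightarrow> 'd set \<Rightarrow> ('i \<Rightarrow> 'd) \<Rightarrow> ('c, 'r, 'i, 'd) interp \<Rightarrow>
   ('c, 'r, 'i, 'd) tinterp" where
  "extend_interp D A M e \<Delta> nd I =
     \<lparr>universe = \<Delta>,
      cext = \<lambda>B. if B = D then universe I else if B = A then \<Delta>
               else if B \<in> M then insert (e B) (cext I B) else cext I B,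
      rext = rext I, ind = nd,
      prec = \<lambda>i. case i of
                 Op1 \<Rightarrow> {(e B, x) | B x. B \<in> M \<and> x \<in> cext I B}
               | Op2 \<Rightarrow> universe I \<times> (\<Delta> - universe I)\<rparr>"

text \<open>No two steps of \<open>R\<close> can be chained, so any element that lies below another
  one has nothing below itself and is minimal in each set containing it.\<close>

lemma smooth_if_Domain_Range_disjoint:
  assumes "Domain R \<inter> Range R = {}"
  shows "irrefl R" and "trans R"
    and "x \<in> S \<Longrightarrow> x \<in> Min_elems R S \<or> (\<exists>y\<in>Min_elems R S. (y, x) \<in> R)"
  using assms unfolding irrefl_def trans_def Min_elems_def by blast+

text \<open>\<Delta> may contain more than \<open>universe I\<close> and the elements
  \<open>e B\<close>. This allows both a domain built around \<open>I\<close> and the domain of a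
  given model that is to be undercut.\<close>

locale extension =
  fixes D A :: 'c and M :: "'c set" and e :: "'c \<Rightarrow> 'd" and \<Delta> :: "'d set" and nd :: "'i \<Rightarrow> 'd"
    and I :: "('c, 'r, 'i, 'd) interp"
  assumes I: "is_interp I" and subset: "universe I \<subseteq> \<Delta>"
    and DA: "D \<noteq> A" "D \<notin> M" "A \<notin> M"
    and e: "inj_on e M" "e ` M \<subseteq> \<Delta> - universe I"
    and nd: "range nd \<subseteq> \<Delta>"
begin

abbreviation "J \<equiv> extend_interp D A M e \<Delta> nd I"

lemma interp: "cext I B \<subseteq> universe I" "rext I r \<subseteq> universe I \<times> universe I" "universe I \<noteq> {}"
  using I by (auto simp: is_interp_def)

lemma e_notin: "B \<in> M \<Longrightarrow> e B \<notin> universe I" "B \<in> M \<Longrightarrow> e B \<in> \<Delta>"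
  using e by auto

lemma J_simps [simp]:
  "universe J = \<Delta>" "rext J r = rext I r" "ind J = nd"
  "cext J D = universe I" "cext J A = \<Delta>" "B \<in> M \<Longrightarrow> cext J B = insert (e B) (cext I B)"
  "prec J Op1 = {(e B, x) | B x. B \<in> M \<and> x \<in> cext I B}"
  "prec J Op2 = universe I \<times> (\<Delta> - universe I)"
  using DA by (auto simp: extend_interp_def)

lemma cext_J: "B \<noteq> D \<Longrightarrow> B \<noteq> A \<Longrightarrow> cext I B = cext J B \<inter> universe I"
  using interp e_notin by (auto simp: extend_interp_def)

lemma is_tinterp_J: "is_tinterp J"
proof -
  have disj: "Domain (prec J i) \<inter> Range (prec J i) = {}" for i
    using interp(1) e_notin by (cases i) auto
  have "prec J i \<subseteq> universe J \<times> universe J" for i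
    using interp(1) e_notin(2) subset by (cases i) auto
  moreover have "is_interp J"
    using interp e_notin(2) subset nd DA
    by (auto simp: is_interp_def extend_interp_def split: if_splits) blast+
  ultimately show ?thesis
    unfolding is_tinterp_def
    using smooth_if_Domain_Range_disjoint[OF disj] by blast
qed

lemma alc_ext_eq_t_ext_J:
  assumes "D \<notin> cnames C" "A \<notin> cnames C"
  shows "alc_ext I C = t_ext J (emb (star D C)) \<inter> universe I"
  using interp(2) subset assms by (intro alc_ext_eq_t_ext_emb_star I cext_J) auto

text \<open>\<open>e B\<close> lies below all other instances of \<open>B\<close>, and nothing lies
  below \<open>e B\<close> because it is outside \<open>universe I\<close>.\<close>

lemma Min_elems_J: "B \<in> M \<Longrightarrow> Min_elems (prec J Op1) (cext J B) = {e B}"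
  using subsetD[OF interp(1)] e_notin(1) by (auto simp: Min_elems_def)

lemma t_model_J:
  assumes sat: "alc_model \<T> {} I"
    and fresh: "D \<notin> kb_cnames \<T> ({} :: ('c, 'r, 'i) abox)" "A \<notin> kb_cnames \<T> ({} :: ('c, 'r, 'i) abox)"
    and c: "nd c \<in> universe I" and cm: "\<And>B. B \<in> M \<Longrightarrow> nd (cm B) = e B"
  shows "t_model (trans_tbox D A M \<T>) (trans_abox D M c cm) J"
proof -
  have "x \<in> t_ext J (emb (star D C2))"
    if "(C1, C2) \<in> \<T>" "x \<in> universe I" "x \<in> t_ext J (emb (star D C1))" for C1 C2 x
  proof -
    have "D \<notin> cnames C1" "A \<notin> cnames C1" "D \<notin> cnames C2" "A \<notin> cnames C2"
      using that fresh by (auto simp: kb_cnames_def)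
    moreover have "alc_ext I C1 \<subseteq> alc_ext I C2"
      using that sat by (auto simp: alc_model_def sat_kb_def)
    ultimately show ?thesis
      using that by (auto simp: alc_ext_eq_t_ext_J)
  qed
  \<comment> \<open>Since \<open>universe I\<close> is nonempty, each element outside it has a
    predecessor.\<close>
  moreover have "Min_elems (prec J Op2) \<Delta> \<subseteq> universe I"
    using interp(3) subset by (auto simp: Min_elems_def)
  moreover have "e B \<notin> cext J B'" if "B \<in> M" "B' \<in> M" "B' \<noteq> B" for B B'
    using that e(1) interp(1)[of B'] e_notin(1)[of B] by (auto dest: inj_onD)
  ultimately have "sat_kb (tatom_ext J) J (trans_tbox D A M \<T>) (trans_abox D M c cm)"
    using e_notin c subset
    by (auto simp del: J_simps(6-8)
        simp: sat_kb_def trans_tbox_def trans_abox_def Min_elems_J cm)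
  with is_tinterp_J show ?thesis by (simp add: t_model_def)
qed

text \<open>The predecessors of \<open>x\<close> are the \<open>e B'\<close> with \<open>x\<close>
  in \<open>B'\<close>, and among minimized names \<open>e B'\<close> belongs to \<open>B'\<close>
  alone.\<close>

lemma box_minus_J_Op1: "box_minus (trans_L A M) J Op1 = {(x, B). B \<in> M \<and> x \<in> cext I B}"
proof -
  have "e B \<in> cext J B' \<longleftrightarrow> B' = B" if "B \<in> M" "B' \<in> M" for B B'
    using that e(1) interp(1)[of B'] e_notin(1)[of B] by (auto dest: inj_onD)
  with interp(1) subset show ?thesis
    by (fastforce simp del: J_simps(6) simp: box_minus_def neg_box_neg_def)
qed

lemma box_minus_J_Op2: "box_minus (trans_L A M) J Op2 = (\<Delta> - universe I) \<times> {A}"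
  using interp(3) subset by (fastforce simp: box_minus_def neg_box_neg_def)

end


section \<open>Transport along an injection\<close>

definition transport :: "('d \<Rightarrow> 'e) \<Rightarrow> ('c, 'r, 'i, 'd) interp \<Rightarrow> ('c, 'r, 'i, 'e) interp" where
  "transport f I =
     \<lparr>universe = f ` universe I, cext = \<lambda>B. f ` cext I B, rext = \<lambda>r. map_prod f f ` rext I r,
      ind = f \<circ> ind I\<rparr>"

lemma transport_simps [simp]:
  "universe (transport f I) = f ` universe I"
  "cext (transport f I) B = f ` cext I B"
  "rext (transport f I) r = map_prod f f ` rext I r"
  "ind (transport f I) a = f (ind I a)"
  by (simp_all add: transport_def)

lemma is_interp_transport: "is_interp I \<Longrightarrow> is_interp (transport f I)"
  unfolding is_interp_def transport_simps by (intro conjI allI; blast)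

text \<open>Injectivity lets images commute with complement and intersection, and identifies a role
  successor with the instance of \<open>C\<close> that has the same image.\<close>

lemma alc_ext_transport:
  assumes I: "is_interp I" and f: "inj_on f (universe I)"
  shows "alc_ext (transport f I) C = f ` alc_ext I C"
proof (induction C)
  have sub: "alc_ext I C \<subseteq> universe I" for C
    using I by (intro ext_with_subset_universe) (auto simp: is_interp_def)
  {
    case (Neg C)
    then show ?case using sub[of C] f by (simp add: inj_on_image_set_diff[of f "universe I"])
  next
    case (Conj C1 C2)
    then show ?case using sub f by (simp add: inj_on_image_Int[of f "universe I"])
  next
    case (Ex r C)
    have r: "rext I r \<subseteq> universe I \<times> universe I"
      using I by (auto simp: is_interp_def)
    show ?case
    proof (intro set_eqI iffI)
      fix y assume "y \<in> alc_ext (transport f I) (Ex r C)"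
      then obtain x z z' where *: "(x, z) \<in> rext I r" "y = f x" "f z = f z'" "z' \<in> alc_ext I C"
        using Ex by fastforce
      with r sub[of C] f have "z = z'" by (auto dest: inj_onD)
      with * r show "y \<in> f ` alc_ext I (Ex r C)" by auto
    next
      fix y assume "y \<in> f ` alc_ext I (Ex r C)"
      then obtain x z where "y = f x" "x \<in> universe I" "(x, z) \<in> rext I r" "z \<in> alc_ext I C"
        by auto
      then have "y \<in> f ` universe I" "(y, f z) \<in> map_prod f f ` rext I r"
          "f z \<in> alc_ext (transport f I) C"
        unfolding Ex by auto
      then show "y \<in> alc_ext (transport f I) (Ex r C)"
        unfolding ext_with.simps transport_simps(1,3) by (intro CollectI conjI exI)
    qed
  }
qed auto

lemma alc_model_transport:
  assumes "alc_model \<T> \<A> I" and f: "inj_on f (universe I)"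
  shows "alc_model \<T> \<A> (transport f I)"
proof -
  have I: "is_interp I" and sat: "sat_kb (cext I) I \<T> \<A>"
    using assms(1) by (auto simp: alc_model_def)
  have "sat_assertion (cext (transport f I)) (transport f I) \<alpha>"
    if "sat_assertion (cext I) I \<alpha>" for \<alpha>
    using that alc_ext_transport[OF I f] by (cases \<alpha>) auto
  moreover have "alc_ext (transport f I) C1 \<subseteq> alc_ext (transport f I) C2"
    if "alc_ext I C1 \<subseteq> alc_ext I C2" for C1 C2
    using that alc_ext_transport[OF I f] by auto
  ultimately have "sat_kb (cext (transport f I)) (transport f I) \<T> \<A>"
    using sat unfolding sat_kb_def by blast
  with is_interp_transport[OF I] show ?thesis by (simp add: alc_model_def)
qed

lemma circ_less_transport:
  assumes "circ_less CP I J" and "is_interp I" and "is_interp J" and f: "inj_on f (universe J)"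
  shows "circ_less CP (transport f I) (transport f J)"
proof -
  have "f ` cext I B \<subset> f ` cext J B" if "cext I B \<subset> cext J B" for B
  proof -
    have "cext J B \<subseteq> universe J" using assms(3) by (auto simp: is_interp_def)
    with that f show ?thesis
      by (metis image_strict_mono inj_on_subset)
  qed
  then have "\<exists>B\<in>minimized CP. f ` cext I B \<subset> f ` cext J B"
    using assms(1) unfolding circ_less_def by metis
  with assms(1) show ?thesis by (simp add: circ_less_def image_mono)
qed

lemma transport_inverse:
  assumes I: "is_interp I" and g: "\<And>x. x \<in> universe I \<Longrightarrow> g (f x) = x"
  shows "transport g (transport f I) = I"
proof -
  have *: "cext I B \<subseteq> universe I" "rext I r \<subseteq> universe I \<times> universe I" "ind I a \<in> universe I" for B r a
    using I by (auto simp: is_interp_def)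
  have "map_prod (g \<circ> f) (g \<circ> f) p = p" if "p \<in> rext I r" for p r
    using that *(2)[of r] g by auto
  moreover have "(g \<circ> f) x = x" if "x \<in> cext I B" for x B
    using that *(1)[of B] g by auto
  ultimately show ?thesis
    using g *(3)
    by (intro interp.equality)
      (auto simp: transport_def image_image map_prod_def split_beta fun_eq_iff)
qed

text \<open>A smaller model on the image can be pulled back along the inverse of \<open>f\<close>,
  and pulling back the transported model gives \<open>I\<close> itself.\<close>

lemma circ_model_transport:
  assumes I: "circ_model CP \<T> \<A> I" and f: "inj_on f (universe I)"
  shows "circ_model CP \<T> \<A> (transport f I)"
proof -
  let ?g = "inv_into (universe I) f"
  have model: "alc_model \<T> \<A> I" and interp: "is_interp I"
    using I by (auto simp: circ_model_def alc_model_def)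
  have g: "inj_on ?g (f ` universe I)"
    by (rule inj_on_inv_into) simp
  have inv: "transport ?g (transport f I) = I"
    using interp f by (intro transport_inverse) auto
  have False if I': "alc_model \<T> \<A> I'" and less: "circ_less CP I' (transport f I)" for I'
  proof -
    have univ: "universe I' = f ` universe I" using less by (simp add: circ_less_def)
    have "circ_less CP (transport ?g I') I"
      using circ_less_transport[OF less _ is_interp_transport[OF interp], of ?g] I' g inv
      by (simp add: alc_model_def)
    moreover have "alc_model \<T> \<A> (transport ?g I')"
      using I' g univ by (intro alc_model_transport) auto
    ultimately show False using I by (auto simp: circ_model_def)
  qed
  with alc_model_transport[OF model f] show ?thesis by (auto simp: circ_model_def)
qed

section \<open>Room for finitely many new elements\<close>

lemma infinite_make_room:
  assumes "infinite (UNIV :: 'd set)" and "finite M"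
  obtains f :: "'d \<Rightarrow> 'd" and e :: "'c \<Rightarrow> 'd" where "inj f" "inj_on e M" "range f \<inter> e ` M = {}"
proof -
  have "\<exists>(f :: 'd \<Rightarrow> 'd) (e :: 'c \<Rightarrow> 'd). inj f \<and> inj_on e M \<and> range f \<inter> e ` M = {}"
    using assms(2)
  proof (induction M)
    case empty
    have "inj (id :: 'd \<Rightarrow> 'd)" by simp
    then show ?case by (intro exI[of _ id]) simp
  next
    case (insert B M)
    then obtain f :: "'d \<Rightarrow> 'd" and e :: "'c \<Rightarrow> 'd"
      where fe: "inj f" "inj_on e M" "range f \<inter> e ` M = {}" by blast
    \<comment> \<open>Shifting everything by \<open>h\<close> frees the point \<open>a\<close>,
      which becomes the value at the new name \<open>B\<close>.\<close>
    obtain h :: "'d \<Rightarrow> 'd" and a where "bij_betw h UNIV (UNIV - {a})"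
      using infinite_imp_bij_betw[OF assms(1)] by blast
    then have h: "inj h" "a \<notin> range h" by (auto simp: bij_betw_def)
    have "inj (h \<circ> f)" using h(1) fe(1) by (rule inj_compose)
    moreover have img: "((h \<circ> e)(B := a)) ` insert B M = insert a (h ` e ` M)"
      using insert.hyps by auto
    have "inj_on (h \<circ> e) M"
      using fe(2) h(1) by (intro comp_inj_on) (auto intro: inj_on_subset)
    then have "inj_on ((h \<circ> e)(B := a)) M"
      using h(2) by (intro inj_on_fun_updI) auto
    then have "inj_on ((h \<circ> e)(B := a)) (insert B M)"
      using h(2) insert.hyps by auto
    moreover have "h ` range f \<inter> h ` e ` M = {}"
      using fe(3) h(1) by (simp flip: image_Int)
    then have "range (h \<circ> f) \<inter> ((h \<circ> e)(B := a)) ` insert B M = {}"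
      using h(2) unfolding img by auto
    ultimately show ?case by blast
  qed
  then show thesis using that by (elim exE conjE)
qed


section \<open>The equivalence\<close>

lemma t_min_satisfiable_if_circ_satisfiable:
  fixes \<T> :: "('c, 'r) tbox" and c :: 'i
  assumes inf: "infinite (UNIV :: 'd set)"
    and CP: "fixed CP = {}" "minimized CP = M" "finite M"
    and fresh: "D \<noteq> A" "D \<notin> kb_cnames \<T> ({} :: ('c, 'r, 'i) abox) \<union> M \<union> cnames C\<^sub>0"
      "A \<notin> kb_cnames \<T> ({} :: ('c, 'r, 'i) abox) \<union> M \<union> cnames C\<^sub>0"
    and cm: "inj_on cm M" "c \<notin> cm ` M"
    and sat: "circ_satisfiable TYPE('d) CP \<T> ({} :: ('c, 'r, 'i) abox) C\<^sub>0"
  shows "t_min_satisfiable TYPE('d) (trans_L A M)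
           (trans_tbox D A M \<T>) (trans_abox D M c cm) (trans_concept D C\<^sub>0)"
proof -
  obtain I\<^sub>0 :: "('c, 'r, 'i, 'd) interp"
    where I\<^sub>0: "circ_model CP \<T> {} I\<^sub>0" "alc_ext I\<^sub>0 C\<^sub>0 \<noteq> {}"
    using sat by (auto simp: circ_satisfiable_def)
  obtain f :: "'d \<Rightarrow> 'd" and e :: "'c \<Rightarrow> 'd"
    where fe: "inj f" "inj_on e M" "range f \<inter> e ` M = {}"
    using infinite_make_room[OF inf CP(3)] .
  define I where "I = transport f I\<^sub>0"
  have f: "inj_on f (universe I\<^sub>0)" using fe(1) by (rule inj_on_subset) simp
  have circ: "circ_model CP \<T> {} I"
    unfolding I_def using I\<^sub>0(1) f by (rule circ_model_transport)
  then have model: "alc_model \<T> {} I" and interp: "is_interp I"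
    by (auto simp: circ_model_def alc_model_def)
  have C\<^sub>0: "alc_ext I C\<^sub>0 \<noteq> {}"
    using I\<^sub>0 f by (auto simp: I_def alc_ext_transport circ_model_def alc_model_def)
  have e: "e ` M \<inter> universe I = {}" using fe(3) by (auto simp: I_def)
  define nd where "nd a = (if a \<in> cm ` M then e (inv_into M cm a) else ind I a)" for a
  \<comment> \<open>Nothing beyond the \<open>e B\<close> is added: a competitor could move any
    further element into \<open>D\<close>, whereas the ABox keeps the \<open>e B\<close>
    out.\<close>
  define \<Delta> where "\<Delta> = universe I \<union> e ` M"
  have nd: "range nd \<subseteq> \<Delta>" "nd c \<in> universe I" "\<And>B. B \<in> M \<Longrightarrow> nd (cm B) = e B"
    using interp cm by (auto simp: nd_def \<Delta>_def is_interp_def)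
  interpret ext: extension D A M e \<Delta> nd I
    using interp fresh fe(2) e nd(1) by unfold_locales (auto simp: \<Delta>_def)
  have J: "t_model (trans_tbox D A M \<T>) (trans_abox D M c cm) ext.J"
    using model fresh nd(2,3) by (intro ext.t_model_J) auto
  have False
    if J': "t_model (trans_tbox D A M \<T>) (trans_abox D M c cm) J'"
      and pref: "preferred (trans_L A M) J' ext.J" for J'
  proof -
    have univ: "universe J' = \<Delta>" and ind: "ind J' a = nd a"
      and sub: "box_minus (trans_L A M) J' i \<subseteq> box_minus (trans_L A M) ext.J i" for a i
      using pref by (auto simp: preferred_def)
    have J'_kb: "is_interp J'" "sat_kb (tatom_ext J') J' (trans_tbox D A M \<T>) (trans_abox D M c cm)"
      using J' by (auto simp: t_model_def is_tinterp_def)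
    have "e ` M \<inter> cext J' D = {}"
      using sat_kb_trans_aboxD(2)[OF J'_kb(2)] by (auto simp: ind nd(3))
    \<comment> \<open>A point of \<open>universe I\<close> outside \<open>D\<close> would contribute
      a pair for \<open>Op2\<close> that \<open>ext.J\<close> lacks.\<close>
    moreover have "universe I \<subseteq> cext J' D"
      using box_minus_Op2_if_not_in_D[OF J'] sub[of Op2] univ ext.subset
      unfolding ext.box_minus_J_Op2 by blast
    moreover have "cext J' D \<subseteq> \<Delta>" using J'_kb(1) univ by (auto simp: is_interp_def)
    ultimately have D: "cext J' D = universe I" unfolding \<Delta>_def by blast
    \<comment> \<open>With \<open>D\<close> determined, \<open>Op2\<close> has no pair left to lose,
      so the strict inclusion must occur at \<open>Op1\<close>.\<close>
    have "box_minus (trans_L A M) J' Op2 = box_minus (trans_L A M) ext.J Op2"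
      using sub[of Op2] box_minus_Op2_if_not_in_D[OF J'] D univ by (auto simp: ext.box_minus_J_Op2)
    moreover obtain i where "box_minus (trans_L A M) J' i \<subset> box_minus (trans_L A M) ext.J i"
      using pref by (auto simp: preferred_def)
    ultimately have strict: "box_minus (trans_L A M) J' Op1 \<subset> box_minus (trans_L A M) ext.J Op1"
      by (cases i) auto
    let ?I' = "restrict_interp D (ind I) J'"
    note in_box = box_minus_Op1_if_in_D[OF J']
    have "cext ?I' B \<subseteq> cext I B" if "B \<in> M" for B
      using in_box[OF that] sub[of Op1] by (auto simp: ext.box_minus_J_Op1)
    moreover obtain x B where "B \<in> M" "x \<in> cext I B" "(x, B) \<notin> box_minus (trans_L A M) J' Op1"
      using strict by (auto simp: ext.box_minus_J_Op1)
    \<comment> \<open>If \<open>x\<close> were still an instance of \<open>B\<close> inside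
      \<open>D\<close>, the pair \<open>(x, B)\<close> would be forced in \<open>J'\<close>.\<close>
    then have "B \<in> M" "x \<in> cext I B" "x \<notin> cext ?I' B" using in_box by auto
    ultimately have "circ_less CP ?I' I"
      unfolding circ_less_def using CP D by auto
    moreover have "alc_model \<T> {} ?I'"
      using interp D by (intro alc_model_restrict_interp[OF J']) (auto simp: is_interp_def)
    ultimately show False using circ by (auto simp: circ_model_def)
  qed
  with J have "t_min_model (trans_L A M) (trans_tbox D A M \<T>) (trans_abox D M c cm) ext.J"
    by (auto simp: t_min_model_def)
  moreover have "t_ext ext.J (trans_concept D C\<^sub>0) \<noteq> {}"
    using C\<^sub>0 fresh ext.alc_ext_eq_t_ext_J[of C\<^sub>0] by (auto simp: trans_concept_def)
  ultimately show ?thesis by (auto simp: t_min_satisfiable_def)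
qed

text \<open>The elements named by the \<open>cm B\<close> already lie outside \<open>D\<close> and
  are pairwise distinct. Hence a model smaller than the restriction of \<open>J\<close> extends, on
  the same domain and with the same individuals, to a model preferred to \<open>J\<close>.\<close>

lemma circ_satisfiable_if_t_min_satisfiable:
  fixes \<T> :: "('c, 'r) tbox" and c :: 'i
  assumes CP: "fixed CP = {}" "minimized CP = M"
    and fresh: "D \<noteq> A" "D \<notin> kb_cnames \<T> ({} :: ('c, 'r, 'i) abox) \<union> M"
      "A \<notin> kb_cnames \<T> ({} :: ('c, 'r, 'i) abox) \<union> M"
    and sat: "t_min_satisfiable TYPE('d) (trans_L A M)
           (trans_tbox D A M \<T>) (trans_abox D M c cm) (trans_concept D C\<^sub>0)"
  shows "circ_satisfiable TYPE('d) CP \<T> ({} :: ('c, 'r, 'i) abox) C\<^sub>0"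
proof -
  obtain J :: "('c, 'r, 'i, 'd) tinterp"
    where min: "t_min_model (trans_L A M) (trans_tbox D A M \<T>) (trans_abox D M c cm) J"
      and C\<^sub>0: "t_ext J (trans_concept D C\<^sub>0) \<noteq> {}"
    using sat by (auto simp: t_min_satisfiable_def)
  then have J: "t_model (trans_tbox D A M \<T>) (trans_abox D M c cm) J"
    by (simp add: t_min_model_def)
  then have tinterp: "is_tinterp J" and interp: "is_interp J"
    and kb: "sat_kb (tatom_ext J) J (trans_tbox D A M \<T>) (trans_abox D M c cm)"
    by (auto simp: t_model_def is_tinterp_def)
  note abox = sat_kb_trans_aboxD[OF kb, simplified]
  note in_box = box_minus_Op1_if_in_D[OF J]
  \<comment> \<open>Names denoting elements outside \<open>D\<close> are redirected to the
    denotation of \<open>c\<close>, which the assertion \<open>D(c)\<close> places in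
    \<open>D\<close>.\<close>
  define nd where "nd a = (if ind J a \<in> cext J D then ind J a else ind J c)" for a
  have nd: "nd a \<in> cext J D" for a using abox(1) by (simp add: nd_def)
  define I where "I = restrict_interp D nd J"
  have model: "alc_model \<T> {} I"
    unfolding I_def using J nd by (rule alc_model_restrict_interp)
  define e where "e B = ind J (cm B)" for B
  have e: "inj_on e M"
  proof (rule inj_onI, rule ccontr)
    \<comment> \<open>A common value would be a typical instance of \<open>B'\<close>, contradicting
      the assertion that \<open>cm B\<close> is not in \<open>B'\<close>.\<close>
    fix B B' assume *: "B \<in> M" "B' \<in> M" "e B = e B'" "B \<noteq> B'"
    then have "e B \<notin> cext J B'" using abox(4)[of B B'] by (simp add: e_def)
    with * abox(3)[of B'] show False by (simp add: e_def Min_elems_def)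
  qed
  have False if I': "alc_model \<T> {} I'" and less: "circ_less CP I' I" for I'
  proof -
    have univ: "universe I' = cext J D" using less by (simp add: circ_less_def I_def)
    interpret ext: extension D A M e "universe J" "ind J" I'
      using I' interp fresh e univ abox(2)
      by unfold_locales (auto simp: alc_model_def is_interp_def e_def)
    have "t_model (trans_tbox D A M \<T>) (trans_abox D M c cm) ext.J"
      using I' fresh abox(1) univ by (intro ext.t_model_J) (auto simp: e_def)
    moreover have "preferred (trans_L A M) ext.J J"
    proof -
      have sub: "cext I' B \<subseteq> cext J B \<inter> cext J D" if "B \<in> M" for B
        using less that CP by (auto simp: circ_less_def I_def)
      have "box_minus (trans_L A M) ext.J Op1 \<subseteq> box_minus (trans_L A M) J Op1"
        using sub in_box unfolding ext.box_minus_J_Op1 by blast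
      moreover obtain x B where "B \<in> M" "x \<in> cext J B" "x \<in> cext J D" "x \<notin> cext I' B"
        using less CP by (auto simp: circ_less_def I_def)
      then have "(x, B) \<in> box_minus (trans_L A M) J Op1 - box_minus (trans_L A M) ext.J Op1"
        using in_box by (auto simp: ext.box_minus_J_Op1)
      ultimately have Op1: "box_minus (trans_L A M) ext.J Op1 \<subset> box_minus (trans_L A M) J Op1"
        by blast
      \<comment> \<open>Both models have the same complement of \<open>D\<close>, and
        \<open>J\<close> is forced to contain the pairs arising from it.\<close>
      have "box_minus (trans_L A M) ext.J Op2 \<subseteq> box_minus (trans_L A M) J Op2"
        using box_minus_Op2_if_not_in_D[OF J] univ by (auto simp: ext.box_minus_J_Op2)
      with Op1 have "box_minus (trans_L A M) ext.J i \<subseteq> box_minus (trans_L A M) J i" for i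
        by (cases i) (simp_all only: psubset_imp_subset)
      moreover have "\<exists>i. box_minus (trans_L A M) ext.J i \<subset> box_minus (trans_L A M) J i"
        using Op1 ..
      ultimately show ?thesis
        unfolding preferred_def ext.J_simps(1,3) by simp
    qed
    ultimately show False using min unfolding t_min_model_def by blast
  qed
  with model have "circ_model CP \<T> {} I" by (auto simp: circ_model_def)
  moreover have "alc_ext I C\<^sub>0 \<noteq> {}"
    unfolding I_def alc_ext_restrict_interp[OF tinterp nd]
    using C\<^sub>0 by (auto simp: trans_concept_def)
  ultimately show ?thesis by (auto simp: circ_satisfiable_def)
qed

theorem lemma21:
  fixes \<T> :: "('c, 'r) tbox" and \<A> :: "('c, 'r, 'i) abox"
    and CP :: "('c, 'r) circ_pattern" and M :: "'c set"
    and C\<^sub>0 :: "('c, 'r) concept"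
    and D A :: 'c and c :: 'i and cm :: "'c \<Rightarrow> 'i"
  assumes "infinite (UNIV :: 'd set)"
    and "circ_pattern_for \<T> \<A> CP"
    and "\<A> = {}"
    and "fixed CP = {}"
    and "minimized CP = M" and "finite M"
    and "D \<noteq> A"
    and "D \<notin> kb_cnames \<T> \<A> \<union> M \<union> cnames C\<^sub>0"
    and "A \<notin> kb_cnames \<T> \<A> \<union> M \<union> cnames C\<^sub>0"
    and "inj_on cm M" and "c \<notin> cm ` M"
  shows "circ_satisfiable TYPE('d) CP \<T> \<A> C\<^sub>0 \<longleftrightarrow>
         t_min_satisfiable TYPE('d) (trans_L A M)
           (trans_tbox D A M \<T>) (trans_abox D M c cm) (trans_concept D C\<^sub>0)"
  using assms
  by (auto intro: t_min_satisfiable_if_circ_satisfiable circ_satisfiable_if_t_min_satisfiable)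

end
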